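(* Let $H\in\mathbb{C}^{N\times N}$ be Hermitian negative definite, and let $M=\operatorname*{arg\,min}_{X\in S_0}\sum_{i,j}|X_{ij}|$ be the set of elements of $S_0$ with minimal entrywise $\ell^1$ norm. Then $d(S_\mu,M)\to0$ as $\mu\to0^+$.
   Context: $N,m$ are positive integers. For $X\in\mathbb{C}^{N\times m}$, $E_0(X)=\operatorname{tr}\bigl[(2I-X^*X)X^*HX\bigr]$, where $X^*$ is the conjugate transpose, and for $\mu\ge0$, $E_\mu(X)=E_0(X)+\mu\sum_{i,j}|X_{ij}|$. The set $S_\mu$ is the set of all global minimizers of $E_\mu$ over $\mathbb{C}^{N\times m}$ (with $S_0$ the set of global minimizers of $E_0$). For sets $A,B\subset\mathbb{C}^{N\times m}$, $d(A,B)=\sup_{a\in A}\inf_{b\in B}\|a-b\|_F$, where $\|\cdot\|_F$ is the Frobenius norm. *)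

theory Defs
  imports "HOL-Analysis.Analysis"
begin

text \<open>
  An \<open>N \<times> m\<close> complex matrix is an element of \<^typ>\<open>complex ^ 'm ^ 'n\<close>, with \<open>N = CARD('n)\<close>
  and \<open>m = CARD('m)\<close>; both are positive because types are nonempty.
\<close>

definition conj_transpose :: "complex ^ 'm ^ 'n \<Rightarrow> complex ^ 'n ^ 'm" where
  "conj_transpose A = (\<chi> i j. cnj (A $ j $ i))"

definition hermitian :: "complex ^ 'n ^ 'n \<Rightarrow> bool" where
  "hermitian H \<longleftrightarrow> conj_transpose H = H"

text \<open>
  The form \<open>x\<^sup>* H x\<close> is real when \<open>H\<close> is Hermitian, so taking its real part loses nothing.
\<close>

definition hermitian_neg_def :: "complex ^ 'n ^ 'n \<Rightarrow> bool" where
  "hermitian_neg_def H \<longleftrightarrow>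
     hermitian H \<and> (\<forall>x. x \<noteq> 0 \<longrightarrow> Re (\<Sum>i\<in>UNIV. cnj (x $ i) * (H *v x) $ i) < 0)"

text \<open>
  The trace below is a real number when \<open>H\<close> is Hermitian (lemma \<open>energy_trace_real\<close>);
  \<^const>\<open>Re\<close> only changes the type. Note that \<^term>\<open>mat 2\<close> is \<open>2 I\<close>.
\<close>

definition energy0 :: "complex ^ 'n ^ 'n \<Rightarrow> complex ^ 'm ^ 'n \<Rightarrow> real" where
  "energy0 H X =
     Re (trace ((mat 2 - conj_transpose X ** X) ** conj_transpose X ** H ** X))"

definition entry_l1 :: "complex ^ 'm ^ 'n \<Rightarrow> real" where
  "entry_l1 X = (\<Sum>i\<in>UNIV. \<Sum>j\<in>UNIV. cmod (X $ i $ j))"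

definition energy :: "complex ^ 'n ^ 'n \<Rightarrow> real \<Rightarrow> complex ^ 'm ^ 'n \<Rightarrow> real" where
  "energy H \<mu> X = energy0 H X + \<mu> * entry_l1 X"

definition minimizers :: "complex ^ 'n ^ 'n \<Rightarrow> real \<Rightarrow> (complex ^ 'm ^ 'n) set" where
  "minimizers H \<mu> = {X. is_arg_min (energy H \<mu>) (\<lambda>_. True) X}"

definition l1_minimal_minimizers :: "complex ^ 'n ^ 'n \<Rightarrow> (complex ^ 'm ^ 'n) set" where
  "l1_minimal_minimizers H = {X. is_arg_min entry_l1 (\<lambda>Y. Y \<in> minimizers H 0) X}"

text \<open>
  The library norm on \<^typ>\<open>complex ^ 'm ^ 'n\<close> is the Frobenius norm (lemma \<open>norm_eq_frobenius\<close>).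
  The deviation takes values in \<^typ>\<open>ennreal\<close>, so that supremum and infimum are meaningful for
  arbitrary sets; in particular it is \<open>\<infinity>\<close> if only the second set is empty.
\<close>

definition deviation :: "(complex ^ 'm ^ 'n) set \<Rightarrow> (complex ^ 'm ^ 'n) set \<Rightarrow> ennreal" where
  "deviation A B = (SUP a\<in>A. INF b\<in>B. ennreal (norm (a - b)))"

lemma norm_eq_frobenius:
  fixes X :: "complex ^ 'm ^ 'n"
  shows "norm X = sqrt (\<Sum>i\<in>UNIV. \<Sum>j\<in>UNIV. (cmod (X $ i $ j))\<^sup>2)"
  by (simp add: norm_vec_def L2_set_def sum_nonneg)

lemma conj_transpose_mult: "conj_transpose (A ** B) = conj_transpose B ** conj_transpose A"
  by (simp add: conj_transpose_def matrix_matrix_mult_def vec_eq_iff mult.commute)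

lemma conj_transpose_conj_transpose [simp]: "conj_transpose (conj_transpose A) = A"
  by (simp add: conj_transpose_def vec_eq_iff)

lemma trace_conj_transpose: "trace (conj_transpose A) = cnj (trace A)"
  by (simp add: conj_transpose_def trace_def)

lemma energy_trace_real:
  fixes X :: "complex ^ 'm ^ 'n"
  assumes "hermitian H"
  shows "trace ((mat 2 - conj_transpose X ** X) ** conj_transpose X ** H ** X) \<in> \<real>"
proof -
  let ?P = "mat 2 - conj_transpose X ** X" and ?Q = "conj_transpose X ** H ** X"
  have "conj_transpose (A - B) = conj_transpose A - conj_transpose B" for A B :: "complex ^ 'm ^ 'm"
    by (simp add: conj_transpose_def vec_eq_iff)
  moreover have "conj_transpose (mat 2 :: complex ^ 'm ^ 'm) = mat 2"
    by (auto simp: conj_transpose_def mat_def vec_eq_iff)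
  ultimately have P: "conj_transpose ?P = ?P"
    by (simp add: conj_transpose_mult)
  have Q: "conj_transpose ?Q = ?Q"
    using assms by (simp add: hermitian_def conj_transpose_mult matrix_mul_assoc)
  have "cnj (trace (?P ** ?Q)) = trace (?Q ** ?P)"
    by (metis P Q conj_transpose_mult trace_conj_transpose)
  also have "\<dots> = trace (?P ** ?Q)"
    by (rule trace_mul_sym)
  finally show ?thesis
    by (simp add: matrix_mul_assoc Reals_cnj_iff)
qed

end

theory Submission
  imports Defs
begin

text \<open>
  If \<open>a\<close> minimizes \<open>E\<^sub>\<mu>\<close> with \<open>\<mu> > 0\<close> and \<open>y\<close> minimizes \<open>E\<^sub>0\<close>, comparing \<open>E\<^sub>\<mu>(a) \<le> E\<^sub>\<mu>(y)\<close> with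
  \<open>E\<^sub>0(y) \<le> E\<^sub>0(a)\<close> shows that the \<open>\<ell>\<^sup>1\<close> norm of \<open>a\<close> is at most that of \<open>y\<close>. So the minimizers stay
  bounded as \<open>\<mu> \<rightarrow> 0\<close>, and every limit point minimizes \<open>E\<^sub>0\<close> and has minimal \<open>\<ell>\<^sup>1\<close> norm among such
  minimizers. This needs one minimizer of \<open>E\<^sub>0\<close>, which exists because
  \<open>E\<^sub>0(X) = 2 tr(X\<^sup>*HX) + tr(W\<^sup>*(-H)W)\<close> with \<open>W = XX\<^sup>*\<close>, and the quartic term is positive away from \<open>0\<close>.
\<close>

lemma penalized_minimizers_near:
  fixes f g :: "'a::heine_borel \<Rightarrow> real"
  assumes f: "continuous_on UNIV f" and g: "continuous_on UNIV g"
    and bdd: "\<And>c. bounded {x. g x \<le> c}"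
    and x0: "is_arg_min f (\<lambda>_. True) x0" and e: "e > 0"
  shows "\<forall>\<^sub>F \<mu> in at_right 0. \<forall>a. is_arg_min (\<lambda>x. f x + \<mu> * g x) (\<lambda>_. True) a \<longrightarrow>
           (\<exists>b. is_arg_min g (is_arg_min f (\<lambda>_. True)) b \<and> dist a b < e)"
proof (rule ccontr)
  let ?S = "\<lambda>\<mu> a. is_arg_min (\<lambda>x. f x + \<mu> * g x) (\<lambda>_. True) a"
  let ?M = "is_arg_min g (is_arg_min f (\<lambda>_. True))"
  assume "\<not> ?thesis"
  \<comment> \<open>Negating the claim gives, for each \<open>n\<close>, some \<open>\<mu>\<close>
    in (0, 1/(n+1)) and a minimizer at distance at least \<open>e\<close> from every element of
    \<open>?M\<close>.\<close>
  then have "\<exists>\<mu> a. 0 < \<mu> \<and> \<mu> < 1 / real (Suc n) \<and> ?S \<mu> a \<and> (\<forall>b. ?M b \<longrightarrow> e \<le> dist a b)" for n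
    unfolding eventually_at_right_field
    by (auto simp: not_less dest!: spec[where x = "1 / real (Suc n)"])
  then obtain \<mu> a where \<mu>: "\<And>n. 0 < \<mu> n" "\<And>n. \<mu> n < 1 / real (Suc n)"
    and a: "\<And>n. ?S (\<mu> n) (a n)" and far: "\<And>n b. ?M b \<Longrightarrow> e \<le> dist (a n) b"
    by metis
  have fa: "f (a n) + \<mu> n * g (a n) \<le> f y + \<mu> n * g y" for n y
    using a[of n] by (auto simp: is_arg_min_def not_less)
  have min0: "f x0 \<le> f y" for y
    using x0 by (auto simp: is_arg_min_def not_less)
  have min: "is_arg_min f (\<lambda>_. True) y \<longleftrightarrow> f y \<le> f x0" for y
    using min0 by (auto simp: is_arg_min_def not_less intro: order_trans)
  have ga: "g (a n) \<le> g y" if "f y \<le> f x0" for n y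
  proof -
    have "\<mu> n * g (a n) \<le> \<mu> n * g y"
      using fa[of n y] min0[of "a n"] that by linarith
    then show ?thesis using \<mu>(1)[of n] by simp
  qed
  have "bounded (range a)"
    by (rule bounded_subset[OF bdd[of "g x0"]]) (use ga in auto)
  then obtain l s where s: "strict_mono s" and l: "(a \<circ> s) \<longlonglongrightarrow> l"
    using bounded_imp_convergent_subsequence by blast
  have "\<mu> \<longlonglongrightarrow> 0"
    by (rule tendsto_sandwich[OF _ _ tendsto_const LIMSEQ_inverse_real_of_nat])
      (use \<mu> in \<open>auto intro!: always_eventually less_imp_le simp: inverse_eq_divide\<close>)
  then have \<mu>s: "(\<lambda>n. \<mu> (s n)) \<longlonglongrightarrow> 0"
    using LIMSEQ_subseq_LIMSEQ[OF _ s] by (auto simp: o_def)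
  have fl: "(\<lambda>n. f (a (s n))) \<longlonglongrightarrow> f l" and gl: "(\<lambda>n. g (a (s n))) \<longlonglongrightarrow> g l"
    using continuous_on_tendsto_compose[OF f l] continuous_on_tendsto_compose[OF g l]
    by (auto simp: o_def)
  \<comment> \<open>This is \<open>fa\<close> at \<open>x0\<close> in the limit: the penalties
    vanish because \<open>g\<close> converges along the subsequence, so \<open>l\<close> minimizes
    \<open>f\<close>.\<close>
  have "f l + 0 * g l \<le> f x0 + 0 * g x0"
    by (rule LIMSEQ_le[OF tendsto_add[OF fl tendsto_mult[OF \<mu>s gl]]
          tendsto_add[OF tendsto_const tendsto_mult[OF \<mu>s tendsto_const]]])
      (use fa in auto)
  moreover have "g l \<le> g y" if "f y \<le> f x0" for y
    by (rule LIMSEQ_le_const2[OF gl]) (use ga that in auto)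
  ultimately have "?M l"
    by (auto simp: is_arg_min_def[of g] min not_less)
  \<comment> \<open>The limit \<open>l\<close> lies in \<open>?M\<close> itself, so it is a nearby
    point that \<open>far\<close> excludes.\<close>
  then have "e \<le> dist (a (s n)) l" for n
    using far by blast
  moreover have "\<forall>\<^sub>F n in sequentially. dist (a (s n)) l < e"
    using tendstoD[OF l e] by simp
  ultimately show False
    by (auto simp: eventually_sequentially not_le[symmetric])
qed

text \<open>On the ray through a unit vector w, the function is t^4 r(w) - t^2 q(w), which is
  nonnegative once t^2 is at least (max q)/(min r) over the unit sphere. Outside a ball it is thus
  no smaller than its value 0 at the origin, and compactness of the ball does the rest.\<close>

lemma quartic_minus_quadratic_has_minimum:
  fixes q r :: "'a::euclidean_space \<Rightarrow> real"
  assumes q: "continuous_on UNIV q" and r: "continuous_on UNIV r"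
    and q2: "\<And>t x. q (t *\<^sub>R x) = t^2 * q x" and r4: "\<And>t x. r (t *\<^sub>R x) = t^4 * r x"
    and pos: "\<And>x. x \<noteq> 0 \<Longrightarrow> r x > 0"
  shows "\<exists>x. is_arg_min (\<lambda>x. r x - q x) (\<lambda>_. True) x"
proof -
  let ?S = "sphere (0::'a) 1"
  have S: "compact ?S" "?S \<noteq> {}" by auto
  obtain u where u: "u \<in> ?S" "\<And>y. y \<in> ?S \<Longrightarrow> r u \<le> r y"
    using continuous_attains_inf[OF S continuous_on_subset[OF r]] by auto
  obtain v where v: "\<And>y. y \<in> ?S \<Longrightarrow> q y \<le> q v"
    using continuous_attains_sup[OF S continuous_on_subset[OF q]] by blast
  have c: "r u > 0" using u(1) by (intro pos) auto
  \<comment> \<open>The absolute value covers a negative maximum \<open>q v\<close>; only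
    \<open>q v \<le> R^2 * r u\<close> is needed.\<close>
  define R where "R = sqrt (\<bar>q v\<bar> / r u)"
  have R0: "0 \<le> R" using c by (simp add: R_def)
  have z: "r 0 - q 0 = 0"
    using r4[of 0 0] q2[of 0 0] by simp
  obtain m where m: "m \<in> cball 0 R" "\<And>y. y \<in> cball 0 R \<Longrightarrow> r m - q m \<le> r y - q y"
    using continuous_attains_inf[of "cball 0 R" "\<lambda>x. r x - q x"] R0
      continuous_on_subset[OF continuous_on_diff[OF r q], of "cball 0 R"]
    by (metis compact_cball cball_eq_empty not_less subset_UNIV)
  have "r m - q m \<le> r y - q y" for y
  proof (cases "norm y \<le> R")
    case True
    then show ?thesis using m by simp
  next
    case False
    define t w where "t = norm y" and "w = y /\<^sub>R norm y"
    have tR: "R < t" using False by (simp add: t_def)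
    have t: "t > 0" using tR R0 by simp
    have y: "y = t *\<^sub>R w" and w: "w \<in> ?S"
      using t by (auto simp: t_def w_def)
    have "\<bar>q v\<bar> / r u = R^2" using c by (simp add: R_def)
    also have "\<dots> \<le> t^2" using tR R0 by (intro power_mono) auto
    finally have "q v \<le> t^2 * r u" using c by (simp add: field_simps)
    then have "q w \<le> t^2 * r w"
      using v[OF w] mult_left_mono[OF u(2)[OF w], of "t^2"] by simp
    then have "t^2 * q w \<le> t^2 * (t^2 * r w)" by (intro mult_left_mono) auto
    then have "0 \<le> r y - q y"
      by (simp add: y q2 r4 power4_eq_xxxx power2_eq_square mult.assoc)
    moreover have "r m - q m \<le> 0" using m(2)[of 0] z R0 by simp
    ultimately show ?thesis by simp
  qed
  then show ?thesis by (auto simp: is_arg_min_def not_less)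
qed

text \<open>The sign makes the form positive for negative definite \<open>H\<close>. The column type
  is free, since the form is applied both to \<open>X\<close> and to the square matrix
  \<open>X ** conj_transpose X\<close>.\<close>

definition hform :: "complex ^ 'n ^ 'n \<Rightarrow> complex ^ 'm ^ 'n \<Rightarrow> real" where
  "hform H Y = - Re (trace (conj_transpose Y ** H ** Y))"

text \<open>Reduces the matrix form to the vector form in which \<open>hermitian_neg_def\<close> is
  stated.\<close>

lemma hform_eq_sum_columns:
  "hform H Y = (\<Sum>j\<in>UNIV. - Re (\<Sum>i\<in>UNIV. cnj (column j Y $ i) * (H *v column j Y) $ i))"
proof -
  have "trace (conj_transpose Y ** H ** Y) =
      (\<Sum>j\<in>UNIV. \<Sum>i\<in>UNIV. cnj (column j Y $ i) * (H *v column j Y) $ i)"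
    unfolding matrix_mul_assoc[symmetric]
    by (simp add: trace_def matrix_matrix_mult_def conj_transpose_def column_def
        matrix_vector_mult_def)
  then show ?thesis by (simp add: hform_def sum_negf)
qed

lemma hform_pos:
  assumes "hermitian_neg_def H" and "Y \<noteq> 0"
  shows "hform H Y > 0"
proof -
  have nn: "0 \<le> - Re (\<Sum>i\<in>UNIV. cnj (x $ i) * (H *v x) $ i)" for x
    using assms(1) by (cases "x = 0") (auto simp: hermitian_neg_def_def less_imp_le)
  obtain j where "column j Y \<noteq> 0"
    using assms(2) by (auto simp: vec_eq_iff column_def)
  then have "0 < - Re (\<Sum>i\<in>UNIV. cnj (column j Y $ i) * (H *v column j Y) $ i)"
    using assms(1) by (auto simp: hermitian_neg_def_def)
  then show ?thesis
    unfolding hform_eq_sum_columns using nn by (intro sum_pos2[of _ j]) auto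
qed

lemma hform_scaleR: "hform H (t *\<^sub>R Y) = t^2 * hform H Y"
  by (simp add: hform_def trace_def matrix_matrix_mult_def conj_transpose_def
      sum_distrib_left sum_distrib_right power2_eq_square mult_ac algebra_simps)

lemma continuous_hform: "continuous_on UNIV (hform H)"
  unfolding hform_def trace_def matrix_matrix_mult_def conj_transpose_def
  by (simp, intro continuous_intros)

lemma gram_scaleR:
  "(t *\<^sub>R X) ** conj_transpose (t *\<^sub>R X) = t^2 *\<^sub>R (X ** conj_transpose X)"
  by (simp add: vec_eq_iff matrix_matrix_mult_def conj_transpose_def
      scaleR_sum_right power2_eq_square)

lemma continuous_gram: "continuous_on UNIV (\<lambda>X. X ** conj_transpose X)"
  unfolding matrix_matrix_mult_def conj_transpose_def
  by (simp, intro continuous_intros)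

text \<open>The diagonal entries of the Gram matrix are the squared norms of the rows of
  \<open>X\<close>.\<close>

lemma gram_nonzero:
  assumes "X \<noteq> 0"
  shows "X ** conj_transpose X \<noteq> 0"
proof
  assume "X ** conj_transpose X = 0"
  then have "(\<Sum>j\<in>UNIV. X $ i $ j * cnj (X $ i $ j)) = 0" for i
    by (simp add: vec_eq_iff matrix_matrix_mult_def conj_transpose_def)
  then have "complex_of_real (\<Sum>j\<in>UNIV. (cmod (X $ i $ j))\<^sup>2) = 0" for i
    unfolding of_real_sum complex_norm_square .
  then have "(\<Sum>j\<in>UNIV. (cmod (X $ i $ j))\<^sup>2) = 0" for i
    using of_real_eq_0_iff by blast
  then have "X $ i $ j = 0" for i j
    by (simp add: sum_nonneg_eq_0_iff)
  then show False using assms by (simp add: vec_eq_iff)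
qed

text \<open>In the quartic term, cyclicity of the trace moves the leading
  \<open>conj_transpose X\<close> to the end, leaving W H W with W =
  \<open>X ** conj_transpose X\<close>, which is its own conjugate transpose.\<close>

lemma energy0_eq_hform:
  fixes X :: "complex ^ 'm ^ 'n"
  shows "energy0 H X = hform H (X ** conj_transpose X) - 2 * hform H X"
proof -
  let ?A = "conj_transpose X"
  have d: "(A - B) ** C = A ** C - B ** C" for A B :: "complex^'l^'k" and C :: "complex^'j^'l"
    by (simp add: vec_eq_iff matrix_matrix_mult_def left_diff_distrib sum_subtractf)
  have m2: "(mat 2 :: complex^'m^'m) ** C = 2 *\<^sub>R C" for C :: "complex^'k^'m"
    by (simp add: vec_eq_iff matrix_matrix_mult_def mat_def if_distrib[of "\<lambda>x. x * _"]
        sum.delta cong: if_cong) (simp add: scaleR_conv_of_real)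
  have "(mat 2 - ?A ** X) ** ?A ** H ** X = 2 *\<^sub>R (?A ** H ** X) - ?A ** (X ** ?A ** H ** X)"
    by (simp add: matrix_mul_assoc d m2 scalar_matrix_assoc[symmetric])
  moreover have "trace (?A ** (X ** ?A ** H ** X)) = trace (X ** ?A ** H ** X ** ?A)"
    by (rule trace_mul_sym)
  moreover have "trace (2 *\<^sub>R B - C) = 2 * trace B - trace C" for B C :: "complex^'m^'m"
    by (simp add: trace_def sum_subtractf sum_distrib_left scaleR_conv_of_real)
  ultimately show ?thesis
    by (simp add: energy0_def hform_def conj_transpose_mult matrix_mul_assoc)
qed

lemma continuous_energy0: "continuous_on UNIV (energy0 H)"
  unfolding energy0_eq_hform[abs_def]
  by (intro continuous_intros continuous_hform
      continuous_on_compose2[OF continuous_hform continuous_gram]) auto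

lemma energy0_has_minimizer:
  assumes "hermitian_neg_def H"
  shows "\<exists>X. is_arg_min (energy0 H) (\<lambda>_. True) X"
  unfolding energy0_eq_hform[abs_def]
  by (rule quartic_minus_quadratic_has_minimum)
    (use assms in \<open>auto intro!: continuous_intros continuous_hform hform_pos gram_nonzero
       continuous_on_compose2[OF continuous_hform continuous_gram]
       simp: hform_scaleR gram_scaleR\<close>)

lemma continuous_entry_l1: "continuous_on UNIV entry_l1"
  unfolding entry_l1_def[abs_def] by (intro continuous_intros)

text \<open>Bounds the sublevel sets of \<open>entry_l1\<close>, the source of compactness in the
  limit argument.\<close>

lemma norm_le_entry_l1: "norm X \<le> entry_l1 X"
  unfolding entry_l1_def norm_vec_def
  by (intro order_trans[OF L2_set_le_sum] sum_mono L2_set_le_sum) auto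

theorem lemma2p5:
  fixes H :: "complex ^ 'n ^ 'n"
  assumes "hermitian_neg_def H"
  shows "((\<lambda>\<mu>. deviation (minimizers H \<mu>) (l1_minimal_minimizers H :: (complex ^ 'm ^ 'n) set))
           \<longlongrightarrow> 0) (at_right 0)"
proof (rule order_tendstoI)
  fix c :: ennreal
  assume "0 < c"
  \<comment> \<open>Being below \<open>c\<close>, \<open>d\<close> is finite even if
    \<open>c\<close> is infinite. The gap \<open>e < c\<close> is needed because distances below
    \<open>e\<close> only give a supremum at most \<open>e\<close>.\<close>
  then obtain d where "0 < d" "d < c" using dense by blast
  then obtain e where e: "e > 0" "ennreal e < c"
    by (cases d) auto
  obtain X0 :: "complex ^ 'm ^ 'n" where X0: "is_arg_min (energy0 H) (\<lambda>_. True) X0"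
    using energy0_has_minimizer[OF assms] by blast
  have "bounded {X :: complex ^ 'm ^ 'n. entry_l1 X \<le> k}" for k
    by (rule boundedI[of _ k]) (auto intro: order_trans[OF norm_le_entry_l1])
  from penalized_minimizers_near[OF continuous_energy0 continuous_entry_l1 this X0 e(1)]
  show "\<forall>\<^sub>F \<mu> in at_right 0. deviation (minimizers H \<mu>)
      (l1_minimal_minimizers H :: (complex ^ 'm ^ 'n) set) < c"
  proof eventually_elim
    case (elim \<mu>)
    have "deviation (minimizers H \<mu>) (l1_minimal_minimizers H :: (complex ^ 'm ^ 'n) set) \<le> ennreal e"
      unfolding deviation_def
    proof (rule SUP_least)
      fix a :: "complex ^ 'm ^ 'n"
      assume "a \<in> minimizers H \<mu>"
      then obtain b where "b \<in> l1_minimal_minimizers H" "dist a b < e"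
        using elim by (auto simp: minimizers_def l1_minimal_minimizers_def energy_def[abs_def])
      then show "(INF b\<in>l1_minimal_minimizers H. ennreal (norm (a - b))) \<le> ennreal e"
        by (intro INF_lower2[of b]) (auto simp: dist_norm intro!: ennreal_leI)
    qed
    then show ?case using e by simp
  qed
\<comment> \<open>The remaining half of \<open>order_tendstoI\<close> concerns bounds below 0, and
  \<open>ennreal\<close> has none.\<close>
qed simp

end
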